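(* Let $\mathcal{K}=\{\kappa_{m,n}:(m,n)\in B\}$. Then $\mathcal{K}$ may be partitioned into three disjoint infinite subsets $$\mathcal{K}=\mathcal{S}\cup\mathcal{C}_+\cup\mathcal{C}_-,$$ where $$\mathcal{S}=\{\kappa_{m,n}: k\in\mathbb{N}_{\ge1}\setminus3\mathbb{N}_{\ge1},\ m=(k^2-1)/3,\ n=m+2k+2\},$$ $$\mathcal{C}_+=\{\kappa_{m,n}:(m,n)\in B,\ n>m+2+2\sqrt{3m+1}\},$$ $$\mathcal{C}_-=\{\kappa_{m,n}:(m,n)\in B,\ 0<n<m+2+2\sqrt{3m+1}\}.$$
   Context: $B=\{(m,n):\ m,n \text{ integers},\ 0\le m\le n,\ (m,n)\ne(0,0)\}$. For $(m,n)\in B$, $\kappa_{m,n}$ denotes the discrete uniform distribution on $\{m,m+1,\dots,n\}$. $\mathbb{N}_{\ge1}$ is the set of positive integers and $3\mathbb{N}_{\ge1}$ the set of positive multiples of three. Terminology: elements of $\mathcal{S}$ are called orthogonal dice, elements of $\mathcal{C}_-$ negative dice and elements of $\mathcal{C}_+$ positive dice; the subscripts refer to the sign of the covariance of the corresponding mixed binomial processes on disjoint functions. *)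

theory Defs
  imports "HOL-Probability.Probability_Mass_Function"
begin

definition index_pairs :: "(int \<times> int) set" where
  "index_pairs = {(m, n). 0 \<le> m \<and> m \<le> n \<and> (m, n) \<noteq> (0, 0)}"

text \<open>The discrete uniform distribution on the integers from m to n. It is only used for
  \<^term>\<open>m \<le> n\<close>, since \<^const>\<open>pmf_of_set\<close> is unspecified on the empty set.\<close>

definition kappa :: "int \<Rightarrow> int \<Rightarrow> int pmf" where
  "kappa m n = pmf_of_set {m..n}"

definition dice :: "int pmf set" where
  "dice = {kappa m n | m n. (m, n) \<in> index_pairs}"

text \<open>The quotient in the first equation is the real one, so the equation itself
  says that it is an integer.\<close>

definition orthogonal_dice :: "int pmf set" where
  "orthogonal_dice = {kappa m n | (k :: nat) m n.
     k \<in> {1..} - {3 * j | j. j \<in> {1..}} \<and>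
     real_of_int m = ((real k)\<^sup>2 - 1) / 3 \<and>
     n = m + 2 * int k + 2}"

definition positive_dice :: "int pmf set" where
  "positive_dice = {kappa m n | m n. (m, n) \<in> index_pairs \<and>
     real_of_int n > real_of_int m + 2 + 2 * sqrt (3 * real_of_int m + 1)}"

definition negative_dice :: "int pmf set" where
  "negative_dice = {kappa m n | m n. (m, n) \<in> index_pairs \<and>
     0 < n \<and> real_of_int n < real_of_int m + 2 + 2 * sqrt (3 * real_of_int m + 1)}"

end

theory Submission
  imports Defs
begin

text \<open>
  For \<open>N\<close> uniform on \<open>{m..n}\<close> and \<open>d = n - m\<close>, the covariance of the mixed binomial process on
  disjoint functions has the sign of
  \<open>Var N - E N = (d\<^sup>2 - 4 * d - 12 * m) / 12 = ((d - 2)\<^sup>2 - 4 * (3 * m + 1)) / 12\<close>.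
  For \<open>(m, n) \<noteq> (0, 0)\<close> this is the sign of \<open>d - 2 - 2 * sqrt (3 * m + 1)\<close>, the \<open>excess\<close> below,
  because the smaller root \<open>d = 2 - 2 * sqrt (3 * m + 1)\<close> is nonpositive and is attained by an
  admissible \<open>d\<close> only at \<open>(0, 0)\<close>. So the three classes are the images under \<open>kappa\<close> of the three
  sign classes of a single real function on index pairs. They cover all dice by trichotomy, and
  they are disjoint because a uniform distribution determines its support, hence its endpoints
  (\<open>inj_on_kappa\<close>).

  The arithmetic lies in the class of excess zero (\<open>excess_eq_0_iff\<close>). There
  \<open>sqrt (3 * m + 1)\<close> is rational, so it is an integer \<open>k\<close>, and \<open>k\<^sup>2 = 3 * m + 1\<close> can be solved for
  \<open>m\<close> exactly when \<open>3\<close> does not divide \<open>k\<close>.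
\<close>

definition excess :: "int \<times> int \<Rightarrow> real" where
  "excess = (\<lambda>(m, n). real_of_int n - (real_of_int m + 2 + 2 * sqrt (3 * real_of_int m + 1)))"

lemma inj_on_kappa: "inj_on (\<lambda>(m, n). kappa m n) index_pairs"
proof (rule inj_onI, clarify)
  fix m n m' n' :: int
  assume "(m, n) \<in> index_pairs" "(m', n') \<in> index_pairs" and eq: "kappa m n = kappa m' n'"
  then have le: "m \<le> n" "m' \<le> n'"
    by (auto simp: index_pairs_def)
  have "set_pmf (kappa m n) = set_pmf (kappa m' n')"
    using eq by simp
  with le have "{m..n} = {m'..n'}"
    by (simp add: kappa_def)
  with le show "m = m' \<and> n = n'"
    by auto
qed

lemma dice_eq_image: "dice = (\<lambda>(m, n). kappa m n) ` index_pairs"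
  by (auto simp: dice_def)

lemma positive_dice_eq_image:
  "positive_dice = (\<lambda>(m, n). kappa m n) ` {p \<in> index_pairs. excess p > 0}"
  by (fastforce simp: positive_dice_def excess_def)

lemma negative_dice_eq_image:
  "negative_dice = (\<lambda>(m, n). kappa m n) ` {p \<in> index_pairs. excess p < 0}"
proof -
  have "0 < n" if "(m, n) \<in> index_pairs" for m n
    using that by (auto simp: index_pairs_def)
  then show ?thesis
    by (fastforce simp: negative_dice_def excess_def)
qed

lemma sqrt_eq_half_int_imp_int:
  fixes a b :: int
  assumes "sqrt (real_of_int a) = real_of_int b / 2" and "0 \<le> a"
  obtains k :: nat where "a = (int k)\<^sup>2" and "b = 2 * int k"
proof -
  have "real_of_int a = (real_of_int b / 2)\<^sup>2"
    using assms by (metis of_int_0_le_iff real_sqrt_pow2)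
  then have "real_of_int (4 * a) = real_of_int (b\<^sup>2)"
    by (simp add: power_divide)
  then have sq: "4 * a = b\<^sup>2"
    by (simp only: of_int_eq_iff)
  then have "even (b\<^sup>2)"
    by (metis dvd_mult2 even_numeral)
  then have "even b"
    by simp
  then obtain c where c: "b = 2 * c" ..
  have "0 \<le> real_of_int b / 2"
    unfolding assms(1)[symmetric] using assms(2) by simp
  then have "0 \<le> c"
    by (simp add: c)
  moreover have "a = c\<^sup>2"
    using sq by (simp add: c power_mult_distrib)
  ultimately show ?thesis
    using that[of "nat c"] c by simp
qed

text \<open>Squares are \<open>0\<close> or \<open>1\<close> modulo \<open>3\<close>, which is why exactly the \<open>k\<close> coprime to \<open>3\<close> give an
  integer \<open>m\<close>.\<close>

lemma excess_eq_0_iff: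
  "(m, n) \<in> index_pairs \<and> excess (m, n) = 0 \<longleftrightarrow>
    (\<exists>k::nat. 1 \<le> k \<and> \<not> 3 dvd k \<and> 3 * m + 1 = (int k)\<^sup>2 \<and> n = m + 2 * int k + 2)"
  (is "?L \<longleftrightarrow> ?R")
proof
  assume L: ?L
  then have m: "0 \<le> m"
    by (simp add: index_pairs_def)
  have "sqrt (real_of_int (3 * m + 1)) = real_of_int (n - m - 2) / 2"
    using L by (simp add: excess_def)
  then obtain k where k: "3 * m + 1 = (int k)\<^sup>2" "n - m - 2 = 2 * int k"
    using m by (elim sqrt_eq_half_int_imp_int) auto
  have "\<not> 3 dvd k"
  proof
    assume "3 dvd k"
    then obtain l where l: "k = 3 * l" ..
    have "3 * m + 1 = 3 * (3 * (int l)\<^sup>2)"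
      using k(1) by (simp add: l power_mult_distrib)
    then show False
      by presburger
  qed
  moreover from this have "1 \<le> k"
    by (cases k) auto
  ultimately show ?R
    using k by (intro exI[of _ k]) auto
next
  assume ?R
  then obtain k :: nat where k: "1 \<le> k" "3 * m + 1 = (int k)\<^sup>2" "n = m + 2 * int k + 2"
    by blast
  have "1 \<le> (int k)\<^sup>2"
    using k(1) by (simp add: one_le_power)
  then have "0 \<le> m"
    using k(2) by simp
  moreover have "3 * real_of_int m + 1 = (real k)\<^sup>2"
    using arg_cong[OF k(2), of real_of_int] by simp
  then have "sqrt (3 * real_of_int m + 1) = real k"
    by simp
  ultimately show ?L
    using k(3) by (simp add: index_pairs_def excess_def)
qed

lemma non_multiples_of_3_eq: "{1..} - {3 * j | j. j \<in> {1..}} = {k::nat. 1 \<le> k \<and> \<not> 3 dvd k}"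
proof -
  have "k \<in> {3 * j | j. j \<in> {1..}} \<longleftrightarrow> 3 dvd k" if "1 \<le> k" for k :: nat
    using that by (auto elim!: dvdE)
  then show ?thesis
    by auto
qed

lemma orthogonal_dice_eq_image:
  "orthogonal_dice = (\<lambda>(m, n). kappa m n) ` {p \<in> index_pairs. excess p = 0}"
proof -
  have real_eq: "real_of_int m = ((real k)\<^sup>2 - 1) / 3 \<longleftrightarrow> 3 * m + 1 = (int k)\<^sup>2" for m k
  proof -
    have "real_of_int m = ((real k)\<^sup>2 - 1) / 3 \<longleftrightarrow> real_of_int (3 * m + 1) = real_of_int ((int k)\<^sup>2)"
      by (auto simp: field_simps)
    then show ?thesis
      by (simp only: of_int_eq_iff)
  qed
  have eq: "orthogonal_dice = {kappa m n | m n. (m, n) \<in> index_pairs \<and> excess (m, n) = 0}"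
    unfolding orthogonal_dice_def excess_eq_0_iff non_multiples_of_3_eq real_eq mem_Collect_eq
    by blast
  show ?thesis
    unfolding eq by fastforce
qed

lemma infinite_kappa_image:
  assumes "infinite (range f)" and "range f \<subseteq> A" and "A \<subseteq> index_pairs"
  shows "infinite ((\<lambda>(m, n). kappa m n) ` A)"
  using assms by (meson finite_imageD finite_subset inj_on_kappa inj_on_subset)

text \<open>The choice \<open>k = 3 * j + 1\<close> gives \<open>m = 3 * j\<^sup>2 + 2 * j\<close>.\<close>

lemma infinite_orthogonal_dice: "infinite orthogonal_dice"
  unfolding orthogonal_dice_eq_image
proof (rule infinite_kappa_image)
  let ?f = "\<lambda>j::nat. (3 * (int j)\<^sup>2 + 2 * int j, 3 * (int j)\<^sup>2 + 8 * int j + 4)"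
  have "inj ?f"
    \<comment> \<open>The difference of the two components is \<open>6 * j + 4\<close>.\<close>
    by (rule injI) auto
  then show "infinite (range ?f)"
    by (rule range_inj_infinite)
  have "?f j \<in> index_pairs \<and> excess (?f j) = 0" for j
    unfolding excess_eq_0_iff
  proof (intro exI conjI)
    show "\<not> 3 dvd 3 * j + 1"
      by presburger
  qed (auto simp: power2_eq_square algebra_simps)
  then show "range ?f \<subseteq> {p \<in> index_pairs. excess p = 0}"
    by auto
qed auto

lemma infinite_positive_dice: "infinite positive_dice"
  unfolding positive_dice_eq_image
proof (rule infinite_kappa_image)
  let ?f = "\<lambda>j::nat. (0 :: int, 5 + int j)"
  show "infinite (range ?f)"
    by (rule range_inj_infinite) (auto intro: injI)
  show "range ?f \<subseteq> {p \<in> index_pairs. excess p > 0}"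
    by (auto simp: index_pairs_def excess_def)
qed auto

lemma infinite_negative_dice: "infinite negative_dice"
  unfolding negative_dice_eq_image
proof (rule infinite_kappa_image)
  let ?f = "\<lambda>j::nat. (1 + int j, 1 + int j)"
  show "infinite (range ?f)"
    by (rule range_inj_infinite) (auto intro: injI)
  have "- 1 < sqrt (4 + 3 * real j)" for j
    by (rule less_le_trans[of _ 0]) simp_all
  then show "range ?f \<subseteq> {p \<in> index_pairs. excess p < 0}"
    by (auto simp: index_pairs_def excess_def)
qed auto

theorem corollary3p2:
  shows "dice = orthogonal_dice \<union> positive_dice \<union> negative_dice \<and>
    orthogonal_dice \<inter> positive_dice = {} \<and>
    orthogonal_dice \<inter> negative_dice = {} \<and>
    positive_dice \<inter> negative_dice = {} \<and>
    infinite orthogonal_dice \<and> infinite positive_dice \<and> infinite negative_dice"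
proof -
  define K where "K = (\<lambda>(m, n). kappa m n)"
  define Z where "Z = {p \<in> index_pairs. excess p = 0}"
  define P where "P = {p \<in> index_pairs. excess p > 0}"
  define N where "N = {p \<in> index_pairs. excess p < 0}"
  have images: "dice = K ` index_pairs" "orthogonal_dice = K ` Z"
      "positive_dice = K ` P" "negative_dice = K ` N"
    unfolding K_def Z_def P_def N_def
    by (fact dice_eq_image orthogonal_dice_eq_image positive_dice_eq_image
        negative_dice_eq_image)+
  have "index_pairs = Z \<union> P \<union> N"
    by (auto simp: Z_def P_def N_def)
  then have cover: "dice = orthogonal_dice \<union> positive_dice \<union> negative_dice"
    unfolding images by (metis image_Un)
  have disjoint: "K ` A \<inter> K ` B = {}"
    if "A \<subseteq> index_pairs" "B \<subseteq> index_pairs" "A \<inter> B = {}" for A B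
    using inj_on_image_Int[OF inj_on_kappa that(1,2)] that(3) by (simp add: K_def)
  have "K ` Z \<inter> K ` P = {}" "K ` Z \<inter> K ` N = {}" "K ` P \<inter> K ` N = {}"
    by (rule disjoint; auto simp: Z_def P_def N_def)+
  then show ?thesis
    using cover infinite_orthogonal_dice infinite_positive_dice infinite_negative_dice
    by (simp add: images)
qed

end
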